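(* Let $F:\mathbb{R}^d\to\mathbb{R}$ be a convex differentiable function such that $F(s)\le 0$ for all $s\in\mathcal{S}$, and such that for some $L>0$, $F(x+y)\le F(x)+\langle\nabla F(x),y\rangle+\frac{L}{2}\|y\|^2$ for all $x,y\in\mathbb{R}^d$. Let $\eta_1\geq\eta_2\geq\dots\geq\eta_T>0$ be step sizes. Then for every sequence of losses $\ell_1,\dots,\ell_T\in\mathbb{R}^d$ and predictions $m_1,\dots,m_T\in\mathbb{R}^d$, if the iterates $x_1,\dots,x_T$ are produced by optimistic Lagrangian hedging with potential $F$, step sizes $\eta_t$ and predictions $m_t$, then $$F(\eta_T s_{1:T})\le\frac{L}{2}\sum_{t=1}^T\eta_T\,\eta_t\,\|s_t-m_t\|^2 .$$
   Context: $\mathcal{X}\subset\mathbb{R}^d$ is a nonempty convex compact set, and $u\in\mathbb{R}^d$ is a vector with $\langle u,x\rangle=1$ for all $x\in\mathcal{X}$. $\|\cdot\|$ is a norm on $\mathbb{R}^d$. The safe set is the polar cone $\mathcal{S}=\{s\in\mathbb{R}^d:\langle s,x\rangle\le 0\ \forall x\in\mathcal{X}\}$. Online linear optimization: in each round $t=1,\dots,T$ the algorithm selects $x_t\in\mathcal{X}$, and then a loss vector $\ell_t\in\mathbb{R}^d$ (arbitrary, possibly chosen adversarially after seeing $x_t$) is revealed. Put $s_t=\langle\ell_t,x_t\rangle u-\ell_t$, $s_{1:0}=0$ and $s_{1:t}=\sum_{k=1}^t s_k$ (the regret vector). Optimistic Lagrangian hedging: in round $t$, a prediction $m_t\in\mathbb{R}^d$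 is available before $x_t$ is chosen. Let $g_t=\nabla F(\eta_t(s_{1:t-1}+m_t))$. If $\langle g_t,u\rangle>0$ then $x_t=g_t/\langle g_t,u\rangle$; otherwise $x_t$ is an arbitrary element of $\mathcal{X}$. (Under the assumptions on $F$ this rule always gives $x_t\in\mathcal{X}$.) *)

theory Defs
  imports "HOL-Analysis.Analysis"
begin

(* The library's norm on real^'n is fixed to be the Euclidean one; an arbitrary norm is
   a function with the axioms of the class real_normed_vector (which imply N x \<ge> 0). *)
definition is_norm :: "('a::real_vector \<Rightarrow> real) \<Rightarrow> bool" where
  "is_norm N \<longleftrightarrow>
     (\<forall>x. N x = 0 \<longleftrightarrow> x = 0) \<and>
     (\<forall>c x. N (c *\<^sub>R x) = \<bar>c\<bar> * N x) \<and>
     (\<forall>x y. N (x + y) \<le> N x + N y)"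

definition gradient :: "('a::real_inner \<Rightarrow> real) \<Rightarrow> 'a \<Rightarrow> 'a" where
  "gradient F x = (THE g. GDERIV F x :> g)"

lemma gradient_eqI:
  assumes "GDERIV F x :> g"
  shows "gradient F x = g"
  unfolding gradient_def
proof (rule the_equality)
  show "GDERIV F x :> g" by (rule assms)
next
  fix h assume h: "GDERIV F x :> h"
  have "(\<lambda>y. y \<bullet> h) = (\<lambda>y. y \<bullet> g)"
    using h assms unfolding gderiv_def by (rule has_derivative_unique)
  then have "(h - g) \<bullet> (h - g) = 0"
    by (simp add: fun_eq_iff inner_diff_right)
  then show "h = g" by simp
qed

lemma GDERIV_gradient:
  fixes F :: "'a::euclidean_space \<Rightarrow> real"
  assumes "F differentiable (at x)"
  shows "GDERIV F x :> gradient F x"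
proof -
  obtain F' where F': "(F has_derivative F') (at x)"
    using assms by (auto simp: differentiable_def)
  then have "linear F'" by (rule has_derivative_linear)
  then have "F' = (\<lambda>h. h \<bullet> adjoint F' 1)"
    by (simp add: adjoint_works fun_eq_iff)
  with F' have "GDERIV F x :> adjoint F' 1"
    unfolding gderiv_def by simp
  then show ?thesis by (simp add: gradient_eqI)
qed

definition safe_set :: "'a::real_inner set \<Rightarrow> 'a set" where
  "safe_set X = {s. \<forall>x\<in>X. s \<bullet> x \<le> 0}"

definition instant_regret ::
  "'a::real_inner \<Rightarrow> (nat \<Rightarrow> 'a) \<Rightarrow> (nat \<Rightarrow> 'a) \<Rightarrow> nat \<Rightarrow> 'a" where
  "instant_regret u l x t = (l t \<bullet> x t) *\<^sub>R u - l t"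

definition cumulative_regret ::
  "'a::real_inner \<Rightarrow> (nat \<Rightarrow> 'a) \<Rightarrow> (nat \<Rightarrow> 'a) \<Rightarrow> nat \<Rightarrow> 'a" where
  "cumulative_regret u l x t = (\<Sum>k=1..t. instant_regret u l x k)"

(* The rule is a relation, not a function, because x t is an arbitrary point of X
   when the gradient has no positive u-component. Rounds are 1, ..., T. *)
definition optimistic_lagrangian_hedging ::
  "'a::real_inner set \<Rightarrow> 'a \<Rightarrow> ('a \<Rightarrow> real) \<Rightarrow> (nat \<Rightarrow> real) \<Rightarrow> (nat \<Rightarrow> 'a) \<Rightarrow> (nat \<Rightarrow> 'a) \<Rightarrow>
     nat \<Rightarrow> (nat \<Rightarrow> 'a) \<Rightarrow> bool" where
  "optimistic_lagrangian_hedging X u F \<eta> m l T x \<longleftrightarrow>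
     (\<forall>t\<in>{1..T}.
        let g = gradient F (\<eta> t *\<^sub>R (cumulative_regret u l x (t - 1) + m t))
        in if g \<bullet> u > 0 then x t = (1 / (g \<bullet> u)) *\<^sub>R g else x t \<in> X)"

end

theory Submission
  imports Defs
begin

text \<open>
  The gradient of a convex function that is nonpositive on the cone \<open>safe_set X\<close> lies in the
  polar of that cone. As \<open>- u\<close> is an interior point of the cone, such a gradient \<open>g\<close> vanishes
  unless \<open>g \<bullet> u > 0\<close>. Hence the gradient is always orthogonal to the instantaneous regret, since
  the latter is orthogonal to the iterate. Smoothness at \<open>\<eta> t *\<^sub>R (R + m t)\<close>, where \<open>R\<close> is the
  regret before round \<open>t\<close>, together with the tangent inequality at the same point, bounds the
  growth of \<open>F\<close> at scale \<open>\<eta> t\<close> by a quadratic term. Convexity and \<open>F 0 \<le> 0\<close> make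
  \<open>F (c *\<^sub>R R) / c\<close> monotone in \<open>c > 0\<close>, so that the bounds of successive rounds telescope.
\<close>

text \<open>Restricting \<open>F\<close> to the line through \<open>y\<close> and \<open>z\<close>
  reduces this to the tangent inequality for a convex function of one real variable.\<close>

lemma convex_on_gradient_ineq:
  fixes F :: "'a::euclidean_space \<Rightarrow> real"
  assumes "convex_on UNIV F" and "F differentiable (at y)"
  shows "F z \<ge> F y + gradient F y \<bullet> (z - y)"
proof -
  define \<phi> where "\<phi> = (\<lambda>t::real. F (y + t *\<^sub>R (z - y)))"
  have "convex_on UNIV \<phi>"
  proof (rule convex_onI)
    fix t a b :: real
    assume t: "0 < t" "t < 1"
    have "y + ((1 - t) *\<^sub>R a + t *\<^sub>R b) *\<^sub>R (z - y)
        = (1 - t) *\<^sub>R (y + a *\<^sub>R (z - y)) + t *\<^sub>R (y + b *\<^sub>R (z - y))"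
      by (simp add: algebra_simps)
    then show "\<phi> ((1 - t) *\<^sub>R a + t *\<^sub>R b) \<le> (1 - t) * \<phi> a + t * \<phi> b"
      using convex_onD[OF assms(1), of t] t by (simp add: \<phi>_def)
  qed simp
  moreover have "(\<phi> has_field_derivative gradient F y \<bullet> (z - y)) (at 0)"
  proof -
    have "(F has_derivative (\<lambda>h. h \<bullet> gradient F y)) (at (y + 0 *\<^sub>R (z - y)))"
      using GDERIV_gradient[OF assms(2)] by (simp add: gderiv_def)
    moreover have "((\<lambda>t. y + t *\<^sub>R (z - y)) has_derivative (\<lambda>t. t *\<^sub>R (z - y))) (at 0)"
      by (auto intro!: derivative_eq_intros)
    ultimately have "(\<phi> has_derivative (\<lambda>t. t *\<^sub>R (z - y) \<bullet> gradient F y)) (at 0)"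
      unfolding \<phi>_def by (rule has_derivative_compose[rotated])
    then show ?thesis
      by (rule has_derivative_imp_has_field_derivative) (simp add: inner_commute)
  qed
  ultimately have "\<phi> 1 - \<phi> 0 \<ge> gradient F y \<bullet> (z - y) * (1 - 0)"
    by (intro convex_on_imp_above_tangent[where A = UNIV]) auto
  then show ?thesis by (simp add: \<phi>_def)
qed

text \<open>\<open>F\<close> lies above its tangent at \<open>y\<close>. A positive slope along
  \<open>s\<close> would make this tangent positive far out on the ray of \<open>s\<close>, which
  stays in the cone, where \<open>F\<close> is nonpositive.\<close>

lemma gradient_inner_safe_set_le_0:
  fixes F :: "'a::euclidean_space \<Rightarrow> real"
  assumes "convex_on UNIV F" and "F differentiable (at y)"
    and neg: "\<And>s. s \<in> safe_set X \<Longrightarrow> F s \<le> 0"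
    and s: "s \<in> safe_set X"
  shows "gradient F y \<bullet> s \<le> 0"
proof (rule ccontr)
  assume "\<not> ?thesis"
  then have pos: "gradient F y \<bullet> s > 0" by simp
  define a where "a = F y - gradient F y \<bullet> y"
  \<comment> \<open>The tangent at \<open>y\<close> takes the value \<open>a\<close> at the origin,
    so this scaling raises it to at least 1 at \<open>c *\<^sub>R s\<close>.\<close>
  define c where "c = (\<bar>a\<bar> + 1) / (gradient F y \<bullet> s)"
  have "c *\<^sub>R s \<in> safe_set X"
    using s pos by (simp add: safe_set_def c_def mult_nonneg_nonpos divide_nonpos_pos)
  then have "F (c *\<^sub>R s) \<le> 0" by (rule neg)
  moreover have "F (c *\<^sub>R s) \<ge> a + c * (gradient F y \<bullet> s)"
    using convex_on_gradient_ineq[OF assms(1,2), of "c *\<^sub>R s"]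
    by (simp add: a_def inner_diff_right)
  moreover have "c * (gradient F y \<bullet> s) = \<bar>a\<bar> + 1"
    using pos by (simp add: c_def)
  ultimately show False by linarith
qed

lemma polar_safe_set_eq_0:
  fixes g :: "'a::real_inner"
  assumes "bounded X" and u: "\<And>y. y \<in> X \<Longrightarrow> u \<bullet> y = 1"
    and polar: "\<And>s. s \<in> safe_set X \<Longrightarrow> g \<bullet> s \<le> 0"
    and "g \<bullet> u \<le> 0"
  shows "g = 0"
proof -
  obtain B where B: "B > 0" "\<And>y. y \<in> X \<Longrightarrow> norm y \<le> B"
    using assms(1) by (auto simp: bounded_pos)
  \<comment> \<open>Small enough that moving from \<open>- u\<close> by
    \<open>\<epsilon> *\<^sub>R g\<close> stays in the cone. The added 1 keeps the denominator
    positive when \<open>g = 0\<close>.\<close>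
  define \<epsilon> where "\<epsilon> = 1 / (B * (norm g + 1))"
  have \<epsilon>: "\<epsilon> > 0" using B by (simp add: \<epsilon>_def add_nonneg_pos)
  have "\<epsilon> * (g \<bullet> y) \<le> 1" if "y \<in> X" for y
  proof -
    have "g \<bullet> y \<le> norm g * norm y" by (rule norm_cauchy_schwarz)
    also have "\<dots> \<le> (norm g + 1) * B" using B that by (intro mult_mono) auto
    finally show ?thesis
      using B by (simp add: \<epsilon>_def divide_simps add_nonneg_pos mult.commute)
  qed
  then have "- u + \<epsilon> *\<^sub>R g \<in> safe_set X"
    by (auto simp: safe_set_def inner_diff_left inner_add_left u)
  then have "\<epsilon> * (g \<bullet> g) \<le> g \<bullet> u"
    using polar[of "- u + \<epsilon> *\<^sub>R g"] by (simp add: inner_add_right inner_diff_right)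
  with assms(4) have "\<epsilon> * (g \<bullet> g) \<le> 0" by linarith
  with \<epsilon> show ?thesis by (metis inner_gt_zero_iff mult_pos_pos not_less)
qed

text \<open>The point \<open>a *\<^sub>R r\<close> lies between 0 and \<open>b *\<^sub>R r\<close>.
  This is what permits the step size to decrease from one round to the next.\<close>

lemma convex_on_scaled_mono:
  fixes F :: "'a::real_vector \<Rightarrow> real"
  assumes "convex_on UNIV F" and "F 0 \<le> 0" and "0 < a" and "a \<le> b"
  shows "F (a *\<^sub>R r) / a \<le> F (b *\<^sub>R r) / b"
proof -
  have ab: "0 \<le> a / b" "a / b \<le> 1" using assms by auto
  have "F (a *\<^sub>R r) = F ((1 - a / b) *\<^sub>R 0 + (a / b) *\<^sub>R (b *\<^sub>R r))"
    using assms by simp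
  also have "\<dots> \<le> (1 - a / b) * F 0 + (a / b) * F (b *\<^sub>R r)"
    using ab by (intro convex_onD[OF assms(1)]) auto
  also have "\<dots> \<le> (a / b) * F (b *\<^sub>R r)"
    using ab assms(2) by (simp add: mult_nonneg_nonpos)
  finally show ?thesis using assms by (simp add: field_simps)
qed

lemma hedging_gradient_orthogonal:
  fixes F :: "'a::euclidean_space \<Rightarrow> real"
  assumes "bounded X" and "\<And>y. y \<in> X \<Longrightarrow> u \<bullet> y = 1"
    and "convex_on UNIV F" and "\<And>y. F differentiable (at y)"
    and "\<And>s. s \<in> safe_set X \<Longrightarrow> F s \<le> 0"
    and "optimistic_lagrangian_hedging X u F \<eta> m l T x" and "t \<in> {1..T}"
    and g: "g = gradient F (\<eta> t *\<^sub>R (cumulative_regret u l x (t - 1) + m t))"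
  shows "g \<bullet> instant_regret u l x t = 0"
proof (cases "g \<bullet> u > 0")
  case True
  then have x: "x t = (1 / (g \<bullet> u)) *\<^sub>R g"
    using assms(6,7) unfolding optimistic_lagrangian_hedging_def Let_def g by auto
  show ?thesis
    \<comment> \<open>Inserting the normalized gradient for \<open>x t\<close>, the term along
      \<open>u\<close> contributes exactly \<open>g \<bullet> l t\<close>, which cancels the loss
      term.\<close>
    using True by (simp add: instant_regret_def x inner_diff_right inner_commute)
next
  case False
  have "g \<bullet> s \<le> 0" if "s \<in> safe_set X" for s
    unfolding g using assms(3-5) that by (rule gradient_inner_safe_set_le_0)
  with assms(1,2) False have "g = 0" by (intro polar_safe_set_eq_0[of X u]) auto
  then show ?thesis by simp
qed

theorem theorem1:
  fixes X :: "(real^'d) set"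
    and u :: "real^'d"
    and N :: "real^'d \<Rightarrow> real"
    and F :: "real^'d \<Rightarrow> real"
    and L :: real
    and \<eta> :: "nat \<Rightarrow> real"
    and T :: nat
    and l m x :: "nat \<Rightarrow> real^'d"
  assumes "X \<noteq> {}" and "convex X" and "compact X"
    and "\<And>y. y \<in> X \<Longrightarrow> u \<bullet> y = 1"
    and "is_norm N"
    and "convex_on UNIV F"
    and "\<And>y. F differentiable (at y)"
    and "\<And>s. s \<in> safe_set X \<Longrightarrow> F s \<le> 0"
    and "L > 0"
    and "\<And>y z. F (y + z) \<le> F y + gradient F y \<bullet> z + L / 2 * (N z)\<^sup>2"
    and "T \<ge> 1"
    and "antimono_on {1..T} \<eta>"
    and "\<eta> T > 0"
    and "optimistic_lagrangian_hedging X u F \<eta> m l T x"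
  shows "F (\<eta> T *\<^sub>R cumulative_regret u l x T)
           \<le> L / 2 * (\<Sum>t=1..T. \<eta> T * \<eta> t * (N (instant_regret u l x t - m t))\<^sup>2)"
proof -
  let ?R = "cumulative_regret u l x" and ?s = "instant_regret u l x"
  have F0: "F 0 \<le> 0" by (rule assms(8)) (simp add: safe_set_def)
  have \<eta>_mono: "\<eta> j \<le> \<eta> i" if "1 \<le> i" "i \<le> j" "j \<le> T" for i j
    using assms(12) that by (auto simp: monotone_on_def)
  have \<eta>_pos: "\<eta> t > 0" if "1 \<le> t" "t \<le> T" for t
    using \<eta>_mono[of t T] that assms(13) by linarith
  have step: "F (\<eta> t *\<^sub>R ?R t) / \<eta> t
      \<le> F (\<eta> t *\<^sub>R ?R (t - 1)) / \<eta> t + L / 2 * (\<eta> t * (N (?s t - m t))\<^sup>2)"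
    if t: "1 \<le> t" "t \<le> T" for t
  proof -
    define y where "y = \<eta> t *\<^sub>R (?R (t - 1) + m t)"
    define g where "g = gradient F y"
    have "?R t = ?R (t - 1) + ?s t"
      using t by (cases t) (auto simp: cumulative_regret_def)
    then have "\<eta> t *\<^sub>R ?R t = y + \<eta> t *\<^sub>R (?s t - m t)"
      by (simp add: y_def algebra_simps)
    then have "F (\<eta> t *\<^sub>R ?R t)
        \<le> F y + g \<bullet> (\<eta> t *\<^sub>R (?s t - m t)) + L / 2 * (N (\<eta> t *\<^sub>R (?s t - m t)))\<^sup>2"
      by (simp only: g_def assms(10))
    moreover have "N (\<eta> t *\<^sub>R (?s t - m t)) = \<eta> t * N (?s t - m t)"
      using assms(5) \<eta>_pos[OF t] by (simp add: is_norm_def)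
    moreover have "g \<bullet> ?s t = 0"
      using hedging_gradient_orthogonal[OF compact_imp_bounded[OF assms(3)] assms(4,6-8,14)] t
      by (simp add: g_def y_def)
    \<comment> \<open>The right-hand inner product is \<open>- \<eta> t * (g \<bullet> m t)\<close>.
      The smoothness bound has the same linear term, as \<open>g\<close> is orthogonal to
      \<open>?s t\<close>, so the prediction survives only in the quadratic term.\<close>
    moreover have "F (\<eta> t *\<^sub>R ?R (t - 1)) \<ge> F y + g \<bullet> (\<eta> t *\<^sub>R ?R (t - 1) - y)"
      unfolding g_def using assms(6,7) by (rule convex_on_gradient_ineq)
    ultimately have "F (\<eta> t *\<^sub>R ?R t)
        \<le> F (\<eta> t *\<^sub>R ?R (t - 1)) + L / 2 * (\<eta> t * N (?s t - m t))\<^sup>2"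
      by (simp add: y_def algebra_simps)
    then show ?thesis
      using \<eta>_pos[OF t] by (simp add: field_simps power2_eq_square)
  qed
  have "F (\<eta> t *\<^sub>R ?R t) / \<eta> t \<le> L / 2 * (\<Sum>k=1..t. \<eta> k * (N (?s k - m k))\<^sup>2)"
    if "1 \<le> t" "t \<le> T" for t
    using that
  proof (induction t rule: nat_induct_at_least)
    case base
    \<comment> \<open>The regret before the first round is the empty sum.\<close>
    have "F (\<eta> 1 *\<^sub>R ?R (1 - 1)) / \<eta> 1 \<le> 0"
      using F0 \<eta>_pos[of 1] base by (simp add: cumulative_regret_def divide_nonpos_pos)
    then have "F (\<eta> 1 *\<^sub>R ?R 1) / \<eta> 1 \<le> L / 2 * (\<eta> 1 * (N (?s 1 - m 1))\<^sup>2)"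
      using step[OF order_refl base] by linarith
    then show ?case by simp
  next
    case (Suc t)
    \<comment> \<open>The left side is what \<open>step\<close> needs at the new step size, the
      right side what the induction hypothesis bounds at the old one.\<close>
    have "F (\<eta> (Suc t) *\<^sub>R ?R (Suc t - 1)) / \<eta> (Suc t) \<le> F (\<eta> t *\<^sub>R ?R t) / \<eta> t"
      using convex_on_scaled_mono[OF assms(6) F0, of "\<eta> (Suc t)" "\<eta> t" "?R t"]
        \<eta>_mono[of t "Suc t"] \<eta>_pos[of "Suc t"] Suc by simp
    moreover have "L / 2 * (\<Sum>k=1..Suc t. \<eta> k * (N (?s k - m k))\<^sup>2)
        = L / 2 * (\<Sum>k=1..t. \<eta> k * (N (?s k - m k))\<^sup>2)
          + L / 2 * (\<eta> (Suc t) * (N (?s (Suc t) - m (Suc t)))\<^sup>2)"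
      by (simp add: distrib_left)
    moreover have "1 \<le> Suc t" by simp
    ultimately show ?case
      using step[of "Suc t"] Suc.IH Suc.prems by linarith
  qed
  \<comment> \<open>Multiplying by \<open>\<eta> T\<close> clears the division and yields the
    weights \<open>\<eta> T * \<eta> t\<close>.\<close>
  from this[OF assms(11) order_refl] show ?thesis
    using assms(13) by (simp add: pos_divide_le_eq sum_distrib_left mult_ac)
qed

end
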